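(* Let $H_{10}$ be the simply connected Lie group with Lie algebra $\mathfrak h_{10}$. For $s_0,s_2,s_5>0$ and $s_1,s_3,s_4\in\mathbb R$ let $$\sigma=\begin{pmatrix}1&0&0&0&0&0\\0&1&0&0&0&0\\0&0&1&0&0&0\\0&0&0&s_0&0&0\\0&0&0&s_1&s_2&0\\0&0&0&s_3&s_4&s_5\end{pmatrix}$$ and let $g_\sigma=\sigma^T\sigma$ be the corresponding left-invariant metric on $H_{10}$. Then $g_\sigma$ has nontrivial index of symmetry if and only if $s_3=\frac{s_1s_4}{s_2}$. In this case the index of symmetry is $1$, and the distribution of symmetry is generated by the left-invariant field $$Y=e_2-\frac{s_1}{s_2}e_3+\frac{s_0^2s_4}{s_2^2s_5}e_5-\frac{s_0^2s_2^2+s_0^2s_4^2}{s_2^2s_5^2}e_6,$$ which does not belong to the center of $\mathfrak h_{10}$.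
   Context: $\mathfrak h_{10}$ is the 6-dimensional real Lie algebra with basis $e_1,\dots,e_6$ and nonzero brackets (up to skew-symmetry) $[e_1,e_2]=-e_4$, $[e_1,e_3]=-e_5$, $[e_1,e_4]=-e_6$. The metric $g_\sigma$ is the left-invariant metric whose inner product on $\mathfrak h_{10}$ is $g_\sigma(e_i,e_j)=(\sigma^T\sigma)_{ij}$. For a left-invariant metric $g$ on this group the isotropy group of the isometry group is discrete, so every Killing field is right-invariant. For $X\in\mathfrak h$ let $X^*$ be the right-invariant field with $X^*_e=X_e$. The distribution of symmetry $\mathfrak s$ is the left-invariant distribution with $\mathfrak s_e=\{X_e: X\in\mathfrak h,\ (\nabla X^* )_e=0\}$, identified with a subspace $\mathfrak s\subset\mathfrak h$; equivalently, $Y\in\mathfrak s$ if and only if $g([X,Y],Z)+g([X,Z],Y)+g([Y,Z],X)=0$ for all $X,Z\in\mathfrak h$. The index of symmetry is $i_{\mathfrak s}(H,g)=\dim\mathfrak s$; it is nontrivial if it is positive. *)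

theory Defs
  imports "HOL-Analysis.Analysis"
begin

section \<open>Levi-Civita connection of a metric given in a global chart\<close>

definition partial_deriv :: "(real^'n \<Rightarrow> real) \<Rightarrow> 'n \<Rightarrow> real^'n \<Rightarrow> real" where
  "partial_deriv f i p = frechet_derivative f (at p) (axis i 1)"

definition christoffel :: "(real^'n \<Rightarrow> real^'n^'n) \<Rightarrow> real^'n \<Rightarrow> 'n \<Rightarrow> 'n \<Rightarrow> 'n \<Rightarrow> real" where
  "christoffel g p k i j = (1/2) * (\<Sum>l\<in>UNIV. matrix_inv (g p) $ k $ l *
     (partial_deriv (\<lambda>q. g q $ j $ l) i p + partial_deriv (\<lambda>q. g q $ i $ l) j p
      - partial_deriv (\<lambda>q. g q $ i $ j) l p))"

text \<open>The value at \<open>p\<close> of the covariant derivative of the vector field \<open>V\<close> in the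
  direction \<open>u\<close>, for the Levi-Civita connection of the metric \<open>g\<close>.\<close>

definition covariant_deriv ::
    "(real^'n \<Rightarrow> real^'n^'n) \<Rightarrow> (real^'n \<Rightarrow> real^'n) \<Rightarrow> real^'n \<Rightarrow> real^'n \<Rightarrow> real^'n" where
  "covariant_deriv g V p u = frechet_derivative V (at p) u
     + (\<chi> k. \<Sum>i\<in>UNIV. \<Sum>j\<in>UNIV. christoffel g p k i j * u $ i * V p $ j)"

section \<open>The Lie algebra and its simply connected Lie group\<close>

text \<open>The index type \<open>6\<close> is the integers modulo 6, so the basis vectors of \<open>real^6\<close> are
  \<open>e 1, \<dots>, e 6\<close>, with \<open>6 = 0\<close> as an index.\<close>

abbreviation e :: "6 \<Rightarrow> real^6" where
  "e i \<equiv> axis i 1"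

definition h10_bracket :: "real^6 \<Rightarrow> real^6 \<Rightarrow> real^6" where
  "h10_bracket x y =
     (x$1 * y$2 - x$2 * y$1) *\<^sub>R (- e 4)
   + (x$1 * y$3 - x$3 * y$1) *\<^sub>R (- e 5)
   + (x$1 * y$4 - x$4 * y$1) *\<^sub>R (- e 6)"

definition h10_center :: "(real^6) set" where
  "h10_center = {z. \<forall>x. h10_bracket x z = 0}"

text \<open>The simply connected group in exponential coordinates. Its unit is \<open>0\<close> and the inverse of
  \<open>x\<close> is \<open>- x\<close>. The Lie algebra is nilpotent of step 3, so the Baker-Campbell-Hausdorff series
  ends after the terms of degree 3.\<close>

definition H10_mult :: "real^6 \<Rightarrow> real^6 \<Rightarrow> real^6" where
  "H10_mult x y = x + y + (1/2) *\<^sub>R h10_bracket x y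
     + (1/12) *\<^sub>R h10_bracket x (h10_bracket x y)
     + (1/12) *\<^sub>R h10_bracket y (h10_bracket y x)"

definition left_invariant_field :: "real^6 \<Rightarrow> real^6 \<Rightarrow> real^6" where
  "left_invariant_field X p = frechet_derivative (\<lambda>q. H10_mult p q) (at 0) X"

definition right_invariant_field :: "real^6 \<Rightarrow> real^6 \<Rightarrow> real^6" where
  "right_invariant_field X p = frechet_derivative (\<lambda>q. H10_mult q p) (at 0) X"

text \<open>The matrix at \<open>p\<close> of the left-invariant metric with Gram matrix \<open>A\<close> at the unit: the
  pullback of \<open>A\<close> under left translation by the inverse of \<open>p\<close>.\<close>

definition left_invariant_metric :: "real^6^6 \<Rightarrow> real^6 \<Rightarrow> real^6^6" where
  "left_invariant_metric A p =
     (let J = matrix (frechet_derivative (\<lambda>q. H10_mult (- p) q) (at p))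
      in transpose J ** A ** J)"

section \<open>Symmetry\<close>

text \<open>All Killing fields of a left-invariant metric on this group are right-invariant, so the
  Killing fields entering the definition of the distribution of symmetry are exactly the fields
  \<open>right_invariant_field X\<close>, whose value at the unit is \<open>X\<close>. The distribution is
  extended from the unit by left invariance.\<close>

definition symmetry_space :: "real^6^6 \<Rightarrow> (real^6) set" where
  "symmetry_space A = {X. \<forall>u.
     covariant_deriv (left_invariant_metric A) (right_invariant_field X) 0 u = 0}"

definition symmetry_distribution :: "real^6^6 \<Rightarrow> real^6 \<Rightarrow> (real^6) set" where
  "symmetry_distribution A p = (\<lambda>X. left_invariant_field X p) ` symmetry_space A"

definition symmetry_index :: "real^6^6 \<Rightarrow> nat" where
  "symmetry_index A = dim (symmetry_space A)"

section \<open>The matrices \<open>\<sigma>\<close> and the metrics\<close>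

definition sigma :: "real \<Rightarrow> real \<Rightarrow> real \<Rightarrow> real \<Rightarrow> real \<Rightarrow> real \<Rightarrow> real^6^6" where
  "sigma s0 s1 s2 s3 s4 s5 = vector
    [vector [1, 0, 0, 0,  0,  0],
     vector [0, 1, 0, 0,  0,  0],
     vector [0, 0, 1, 0,  0,  0],
     vector [0, 0, 0, s0, 0,  0],
     vector [0, 0, 0, s1, s2, 0],
     vector [0, 0, 0, s3, s4, s5]]"

definition g_sigma :: "real \<Rightarrow> real \<Rightarrow> real \<Rightarrow> real \<Rightarrow> real \<Rightarrow> real \<Rightarrow> real^6^6" where
  "g_sigma s0 s1 s2 s3 s4 s5 =
     transpose (sigma s0 s1 s2 s3 s4 s5) ** sigma s0 s1 s2 s3 s4 s5"

section \<open>Checks of the definitions\<close>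

lemma exhaust_6: "(i::6) = 1 \<or> i = 2 \<or> i = 3 \<or> i = 4 \<or> i = 5 \<or> i = 6"
proof (induct i)
  case (of_int z)
  then have "z = 0 \<or> z = 1 \<or> z = 2 \<or> z = 3 \<or> z = 4 \<or> z = 5" by simp arith
  then show ?case by auto
qed

lemma forall_6: "(\<forall>i::6. P i) \<longleftrightarrow> P 1 \<and> P 2 \<and> P 3 \<and> P 4 \<and> P 5 \<and> P 6"
  by (metis exhaust_6)

lemma vector_6 [simp]:
  fixes a b c d u v :: "'a::zero"
  shows "(vector [a,b,c,d,u,v] :: 'a^6) $ 1 = a" "(vector [a,b,c,d,u,v] :: 'a^6) $ 2 = b"
    "(vector [a,b,c,d,u,v] :: 'a^6) $ 3 = c" "(vector [a,b,c,d,u,v] :: 'a^6) $ 4 = d"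
    "(vector [a,b,c,d,u,v] :: 'a^6) $ 5 = u" "(vector [a,b,c,d,u,v] :: 'a^6) $ 6 = v"
  unfolding vector_def by auto

lemma h10_bracket_nth:
  "h10_bracket x y $ 1 = 0" "h10_bracket x y $ 2 = 0" "h10_bracket x y $ 3 = 0"
  "h10_bracket x y $ 4 = x$2 * y$1 - x$1 * y$2"
  "h10_bracket x y $ 5 = x$3 * y$1 - x$1 * y$3"
  "h10_bracket x y $ 6 = x$4 * y$1 - x$1 * y$4"
  by (auto simp: h10_bracket_def axis_def)

lemma H10_assoc: "H10_mult (H10_mult x y) z = H10_mult x (H10_mult y z)"
  unfolding vec_eq_iff forall_6 H10_mult_def
  by (simp add: h10_bracket_nth
      algebra_simps add_divide_distrib diff_divide_distrib)

lemma H10_unit: "H10_mult 0 x = x" "H10_mult x 0 = x"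
  and H10_inverse: "H10_mult (- x) x = 0" "H10_mult x (- x) = 0"
  unfolding vec_eq_iff forall_6 H10_mult_def
  by (simp_all add: h10_bracket_nth)

lemma bounded_bilinear_h10_bracket: "bounded_bilinear h10_bracket"
  unfolding bilinear_conv_bounded_bilinear [symmetric] bilinear_def
  by (intro conjI allI linearI; simp add: vec_eq_iff forall_6 h10_bracket_nth algebra_simps)

lemmas has_derivative_h10_bracket [derivative_intros] =
  bounded_bilinear.FDERIV [OF bounded_bilinear_h10_bracket]

lemma left_invariant_field_eq:
  "left_invariant_field X p =
     X + (1/2) *\<^sub>R h10_bracket p X + (1/12) *\<^sub>R h10_bracket p (h10_bracket p X)"
proof -
  have D: "((\<lambda>q. H10_mult p q) has_derivative (\<lambda>X. X + (1/2) *\<^sub>R h10_bracket p X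
      + (1/12) *\<^sub>R h10_bracket p (h10_bracket p X))) (at 0)"
    unfolding H10_mult_def
    by (rule derivative_eq_intros refl)+
      (simp add: fun_eq_iff vec_eq_iff forall_6 h10_bracket_nth)
  show ?thesis
    unfolding left_invariant_field_def frechet_derivative_at [OF D, symmetric] ..
qed

lemma right_invariant_field_eq:
  "right_invariant_field X p =
     X - (1/2) *\<^sub>R h10_bracket p X + (1/12) *\<^sub>R h10_bracket p (h10_bracket p X)"
proof -
  have D: "((\<lambda>q. H10_mult q p) has_derivative (\<lambda>X. X - (1/2) *\<^sub>R h10_bracket p X
      + (1/12) *\<^sub>R h10_bracket p (h10_bracket p X))) (at 0)"
    unfolding H10_mult_def
    by (rule derivative_eq_intros refl)+
      (simp add: fun_eq_iff vec_eq_iff forall_6 h10_bracket_nth field_simps)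
  show ?thesis
    unfolding right_invariant_field_def frechet_derivative_at [OF D, symmetric] ..
qed

text \<open>The bracket of left-invariant vector fields is the bracket of the Lie algebra.\<close>

lemma lie_bracket_left_invariant_field:
  "frechet_derivative (left_invariant_field Y) (at p) (left_invariant_field X p)
   - frechet_derivative (left_invariant_field X) (at p) (left_invariant_field Y p)
   = left_invariant_field (h10_bracket X Y) p"
proof -
  have L: "(left_invariant_field Z has_derivative (\<lambda>v. (1/2) *\<^sub>R h10_bracket v Z
      + (1/12) *\<^sub>R (h10_bracket p (h10_bracket v Z) + h10_bracket v (h10_bracket p Z)))) (at p)"
    for Z
    unfolding left_invariant_field_eq [abs_def]
    by (rule derivative_eq_intros refl)+
      (simp add: fun_eq_iff vec_eq_iff forall_6 h10_bracket_nth)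
  have D: "frechet_derivative (left_invariant_field Z) (at p) = (\<lambda>v. (1/2) *\<^sub>R h10_bracket v Z
      + (1/12) *\<^sub>R (h10_bracket p (h10_bracket v Z) + h10_bracket v (h10_bracket p Z)))"
    for Z
    by (rule frechet_derivative_at [OF L, symmetric])
  show ?thesis
    unfolding D left_invariant_field_eq vec_eq_iff forall_6
    by (simp add: h10_bracket_nth
      algebra_simps add_divide_distrib diff_divide_distrib)
qed

end

theory Submission
  imports Defs
begin

text \<open>Near the unit the metric at \<open>p\<close> is \<open>A\<close> evaluated on \<open>v - [p, v]/2 + O(p\<^sup>2)\<close>, where \<open>A\<close> is the
  Gram matrix on the Lie algebra and \<open>[p, v]\<close> the bracket. Hence its first derivatives at the unit, and
  with them the Christoffel symbols, are brackets paired with \<open>A\<close>. For the right-invariant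
  field \<open>Y\<^sup>*\<close>, whose derivative at the unit in direction \<open>X\<close> is \<open>- [X, Y]/2\<close>, this gives
  \<open>- 2 A(\<nabla>\<^sub>X Y\<^sup>*, Z) = A([X, Y], Z) + A([X, Z], Y) + A([Y, Z], X)\<close>, and the symmetry space
  becomes the set of \<open>Y\<close> for which this form vanishes in all \<open>X\<close>, \<open>Z\<close> (\<open>symmetry_space_iff\<close>).

  For \<open>g\<^sub>\<sigma>\<close> the vectors \<open>e\<^sub>1, e\<^sub>2, e\<^sub>3\<close> are orthogonal to the derived algebra, spanned by
  \<open>e\<^sub>4, e\<^sub>5, e\<^sub>6\<close>, and brackets arise only from \<open>e\<^sub>1\<close>. The form then depends on \<open>Y\<close> through \<open>y\<^sub>1\<close>,
  the vector \<open>(y\<^sub>4, y\<^sub>5, y\<^sub>6)\<close> and the vector \<open>(y\<^sub>2, y\<^sub>3, y\<^sub>4)\<close> of coordinates of \<open>[Y, e\<^sub>1]\<close>, the last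
  two multiplied by the lower \<open>3 \<times> 3\<close> block of the metric
  (\<open>symmetry_space_g_sigma_iff\<close>). Solving this linear system
  (\<open>symmetry_space_g_sigma_coordinates\<close>) forces \<open>y\<^sub>1 = y\<^sub>4 = 0\<close>, makes \<open>y\<^sub>3, y\<^sub>5, y\<^sub>6\<close> multiples of
  \<open>y\<^sub>2\<close>, and leaves the compatibility condition \<open>(s\<^sub>2 s\<^sub>3 - s\<^sub>1 s\<^sub>4) y\<^sub>2 = 0\<close>. So the symmetry space is the
  line through the given \<open>Y\<close> or zero. As \<open>Y\<close> has \<open>e\<^sub>2\<close>-coordinate 1, it does not commute with \<open>e\<^sub>1\<close>.\<close>

section \<open>The connection at the unit\<close>

lemma sum_UNIV_6: "sum f (UNIV :: 6 set) = f 1 + f 2 + f 3 + f 4 + f 5 + f 6"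
proof -
  have UNIV_6: "(UNIV :: 6 set) = {1, 2, 3, 4, 5, 6}"
    using exhaust_6 by blast
  show ?thesis
    unfolding UNIV_6 by (simp add: add.assoc)
qed

lemma bilinear_h10_bracket: "bilinear h10_bracket"
  by (simp add: bilinear_conv_bounded_bilinear bounded_bilinear_h10_bracket)

lemma linear_h10_bracket: "linear (h10_bracket x)" "linear (\<lambda>x. h10_bracket x y)"
  using bilinear_h10_bracket by (auto simp: bilinear_def)

lemma h10_bracket_skew: "h10_bracket x y = - h10_bracket y x"
  by (simp add: vec_eq_iff forall_6 h10_bracket_nth)

lemma h10_bracket_zero: "h10_bracket 0 y = 0"
  by (simp add: vec_eq_iff forall_6 h10_bracket_nth)

text \<open>The Maurer-Cartan form of the group: the differential at \<open>p\<close> of left translation by the inverse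
  of \<open>p\<close>. In exponential coordinates it is the series \<open>(1 - exp (- ad p)) / ad p\<close>, which ends
  here because the algebra is nilpotent of step 3.\<close>

definition maurer_cartan :: "real^6 \<Rightarrow> real^6 \<Rightarrow> real^6" where
  "maurer_cartan p v = v - (1/2) *\<^sub>R h10_bracket p v
     + (1/6) *\<^sub>R h10_bracket p (h10_bracket p v)"

lemma left_translation_inverse_derivative:
  "frechet_derivative (\<lambda>q. H10_mult (- p) q) (at p) = maurer_cartan p"
proof -
  have "((\<lambda>q. H10_mult (- p) q) has_derivative maurer_cartan p) (at p)"
    unfolding H10_mult_def
    by (rule derivative_eq_intros refl)+
      (simp add: fun_eq_iff vec_eq_iff forall_6 h10_bracket_nth maurer_cartan_def algebra_simps)
  then show ?thesis
    by (rule frechet_derivative_at [symmetric])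
qed

lemma linear_maurer_cartan: "linear (maurer_cartan p)"
  by (rule linearI)
    (simp_all add: vec_eq_iff forall_6 h10_bracket_nth maurer_cartan_def field_simps)

lemma matrix_entry_inner: "M $ i $ j = axis i 1 \<bullet> (M *v axis j (1::real))"
  by (simp add: inner_axis' matrix_vector_mul_component)
   (simp add: inner_axis)

lemma left_invariant_metric_entry:
  "left_invariant_metric A p $ i $ j = maurer_cartan p (e i) \<bullet> (A *v maurer_cartan p (e j))"
proof -
  have "left_invariant_metric A p $ i $ j = e i \<bullet> (left_invariant_metric A p *v e j)"
    by (rule matrix_entry_inner)
  also have "\<dots> = maurer_cartan p (e i) \<bullet> (A *v maurer_cartan p (e j))"
    unfolding left_invariant_metric_def left_translation_inverse_derivative Let_def
    by (simp add: matrix_vector_mul_assoc [symmetric]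
        matrix_works [OF linear_maurer_cartan [folded linear_matrix_vector_mul_eq]]
        dot_lmul_matrix [symmetric] flip: transpose_matrix_vector)
  finally show ?thesis .
qed

lemma left_invariant_metric_0: "left_invariant_metric A 0 = A"
  by (simp add: vec_eq_iff left_invariant_metric_entry maurer_cartan_def h10_bracket_zero
       matrix_entry_inner [symmetric])

lemma left_invariant_metric_partial_deriv:
  "partial_deriv (\<lambda>p. left_invariant_metric A p $ i $ j) l 0 =
     - (1/2) * (h10_bracket (e l) (e i) \<bullet> (A *v e j) + e i \<bullet> (A *v h10_bracket (e l) (e j)))"
proof -
  have D: "((\<lambda>p. maurer_cartan p v) has_derivative (\<lambda>w. - (1/2) *\<^sub>R h10_bracket w v)) (at 0)" for v
    unfolding maurer_cartan_def
    by (rule derivative_eq_intros refl)+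
      (simp add: fun_eq_iff vec_eq_iff forall_6 h10_bracket_nth)
  have "((\<lambda>p. left_invariant_metric A p $ i $ j) has_derivative
      (\<lambda>w. maurer_cartan 0 (e i) \<bullet> (A *v (- (1/2) *\<^sub>R h10_bracket w (e j)))
         + (- (1/2) *\<^sub>R h10_bracket w (e i)) \<bullet> (A *v maurer_cartan 0 (e j)))) (at 0)"
    unfolding left_invariant_metric_entry
    by (intro has_derivative_inner D bounded_linear.has_derivative[OF matrix_vector_mul_bounded_linear])
  from frechet_derivative_at [OF this, symmetric] show ?thesis
    unfolding partial_deriv_def
    by (simp add: maurer_cartan_def h10_bracket_zero matrix_vector_mult_scaleR
      linear_neg[OF matrix_vector_mul_linear] inner_simps algebra_simps)
qed

text \<open>The Christoffel symbols are a bilinear map written in coordinates; this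
  contracts them with two vectors.\<close>

lemma bilinear_coordinates:
  fixes b :: "real^'n \<Rightarrow> real^'n \<Rightarrow> real"
  assumes "bilinear b"
  shows "(\<Sum>i\<in>UNIV. \<Sum>j\<in>UNIV. b (axis i 1) (axis j 1) * u $ i * v $ j) = b u v"
proof -
  have *: "(\<Sum>i\<in>UNIV. x $ i *\<^sub>R axis i 1) = x" for x :: "real^'n"
    using basis_expansion[of x] by (simp add: scalar_mult_eq_scaleR)
  have "b u v = b (\<Sum>i\<in>UNIV. u $ i *\<^sub>R axis i 1) (\<Sum>j\<in>UNIV. v $ j *\<^sub>R axis j 1)"
    by (simp only: *)
  also have "\<dots> = (\<Sum>i\<in>UNIV. \<Sum>j\<in>UNIV. b (axis i 1) (axis j 1) * u $ i * v $ j)"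
    unfolding bilinear_sum[OF assms] sum.cartesian_product[symmetric]
    by (simp add: bilinear_lmul[OF assms] bilinear_rmul[OF assms] mult_ac)
  finally show ?thesis by simp
qed

lemma inner_matrix_symmetric:
  fixes A :: "real^'n^'n"
  assumes "transpose A = A"
  shows "x \<bullet> (A *v y) = y \<bullet> (A *v x)"
  by (metis assms dot_lmul_matrix inner_commute transpose_matrix_vector)

text \<open>Of the six terms \<open>A([e\<^sub>a, e\<^sub>b], e\<^sub>c)\<close> produced by the three derivatives of the metric, the two
  with bracket \<open>[e\<^sub>i, e\<^sub>j]\<close> cancel by skew-symmetry and the other four agree in pairs.\<close>

lemma christoffel_at_unit:
  assumes "transpose A = A"
  shows "christoffel (left_invariant_metric A) 0 k i j =
    (\<Sum>l\<in>UNIV. matrix_inv A $ k $ l *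
      (- (1/2) * (h10_bracket (e i) (e l) \<bullet> (A *v e j) + h10_bracket (e j) (e l) \<bullet> (A *v e i))))"
  unfolding christoffel_def left_invariant_metric_0 left_invariant_metric_partial_deriv
    sum_distrib_left
proof (rule sum.cong, goal_cases)
  case (2 l)
  have s: "e a \<bullet> (A *v h10_bracket x y) = h10_bracket x y \<bullet> (A *v e a)" for a x y
    using inner_matrix_symmetric[OF assms] .
  show ?case
    using h10_bracket_skew[of "e j" "e i"] h10_bracket_skew[of "e l" "e i"]
      h10_bracket_skew[of "e l" "e j"]
    by (simp add: s linear_neg [OF matrix_vector_mul_linear] algebra_simps)
qed simp

lemma covariant_deriv_right_invariant_field:
  assumes "transpose A = A"
  shows "covariant_deriv (left_invariant_metric A) (right_invariant_field Y) 0 X =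
    - (1/2) *\<^sub>R (h10_bracket X Y + matrix_inv A *v
       (\<chi> l. h10_bracket X (e l) \<bullet> (A *v Y) + h10_bracket Y (e l) \<bullet> (A *v X)))"
proof -
  define b where "b l x y = h10_bracket x (e l) \<bullet> (A *v y) + h10_bracket y (e l) \<bullet> (A *v x)"
    for l x y
  have b: "bilinear (b l)" for l
    unfolding bilinear_def b_def
    by (intro conjI allI linearI)
      (simp_all add: linear_add[OF linear_h10_bracket(2)] linear_cmul[OF linear_h10_bracket(2)]
        matrix_vector_right_distrib matrix_vector_mult_scaleR inner_simps algebra_simps)
  have D: "(right_invariant_field Y has_derivative (\<lambda>v. - (1/2) *\<^sub>R h10_bracket v Y)) (at 0)"
    unfolding right_invariant_field_eq [abs_def]
    by (rule derivative_eq_intros refl)+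
      (simp add: fun_eq_iff vec_eq_iff forall_6 h10_bracket_nth)
  have Y: "right_invariant_field Y 0 = Y"
    by (simp add: right_invariant_field_eq h10_bracket_zero)
  have "(\<Sum>i\<in>UNIV. \<Sum>j\<in>UNIV. christoffel (left_invariant_metric A) 0 k i j * X $ i * Y $ j)
      = - (1/2) * (\<Sum>l\<in>UNIV. matrix_inv A $ k $ l * b l X Y)" for k
  proof -
    have "(\<Sum>i\<in>UNIV. \<Sum>j\<in>UNIV. christoffel (left_invariant_metric A) 0 k i j * X $ i * Y $ j)
      = (\<Sum>i\<in>UNIV. \<Sum>j\<in>UNIV. \<Sum>l\<in>UNIV.
           - (1/2) * matrix_inv A $ k $ l * (b l (e i) (e j) * X $ i * Y $ j))"
      unfolding christoffel_at_unit[OF assms] b_def[symmetric] sum_distrib_right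
      by (intro sum.cong refl) simp
    also have "\<dots> = (\<Sum>l\<in>UNIV. \<Sum>i\<in>UNIV. \<Sum>j\<in>UNIV.
           - (1/2) * matrix_inv A $ k $ l * (b l (e i) (e j) * X $ i * Y $ j))"
      by (subst sum.swap, rule sum.cong[OF refl]) (subst sum.swap, rule refl)
    also have "\<dots> = (\<Sum>l\<in>UNIV. - (1/2) * matrix_inv A $ k $ l * b l X Y)"
      by (simp only: sum_distrib_left[symmetric] bilinear_coordinates[OF b])
    finally show ?thesis
      by (simp add: sum_distrib_left mult_ac)
  qed
  then show ?thesis
    unfolding covariant_deriv_def frechet_derivative_at [OF D, symmetric] Y b_def[symmetric]
    by (simp add: vec_eq_iff matrix_vector_mult_def algebra_simps)
qed

text \<open>An invertible \<open>A\<close> may be applied to the covariant derivative without losing information, which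
  removes the inverse matrix; pairing with an arbitrary \<open>Z\<close> then gives the cyclic form.\<close>

lemma symmetry_space_iff:
  assumes "transpose A = A" "invertible A"
  shows "Y \<in> symmetry_space A \<longleftrightarrow>
    (\<forall>X Z. h10_bracket X Y \<bullet> (A *v Z) + h10_bracket X Z \<bullet> (A *v Y)
         + h10_bracket Y Z \<bullet> (A *v X) = 0)"
proof -
  define c where "c X = (\<chi> l. h10_bracket X (e l) \<bullet> (A *v Y) + h10_bracket Y (e l) \<bullet> (A *v X))"
    for X
  have c: "c X \<bullet> Z = h10_bracket X Z \<bullet> (A *v Y) + h10_bracket Y Z \<bullet> (A *v X)" for X Z
  proof -
    define f where "f Z = h10_bracket X Z \<bullet> (A *v Y) + h10_bracket Y Z \<bullet> (A *v X)" for Z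
    have f: "linear f"
      unfolding f_def
      by (rule linearI) (simp_all add: linear_add[OF linear_h10_bracket(1)]
          linear_cmul[OF linear_h10_bracket(1)] inner_simps algebra_simps)
    have "c X \<bullet> Z = (\<Sum>l\<in>UNIV. Z $ l *\<^sub>R f (e l))"
      by (simp add: inner_vec_def c_def f_def mult.commute)
    also have "\<dots> = f (\<Sum>l\<in>UNIV. Z $ l *\<^sub>R e l)"
      by (simp only: linear_sum[OF f] linear_cmul[OF f])
    also have "\<dots> = f Z"
      using basis_expansion[of Z] by (simp add: scalar_mult_eq_scaleR)
    finally show ?thesis
      unfolding f_def .
  qed
  have inv: "matrix_inv A ** A = mat 1" "A ** matrix_inv A = mat 1"
    using someI_ex [OF assms(2) [unfolded invertible_def]] unfolding matrix_inv_def by auto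
  have "Y \<in> symmetry_space A \<longleftrightarrow> (\<forall>X. h10_bracket X Y + matrix_inv A *v c X = 0)"
    unfolding symmetry_space_def covariant_deriv_right_invariant_field[OF assms(1)] c_def
    by simp
  also have "\<dots> \<longleftrightarrow> (\<forall>X. A *v h10_bracket X Y + c X = 0)"
  proof (intro iff_allI iffI)
    fix X assume "h10_bracket X Y + matrix_inv A *v c X = 0"
    then have "A *v (h10_bracket X Y + matrix_inv A *v c X) = 0" by simp
    then show "A *v h10_bracket X Y + c X = 0"
      by (simp add: matrix_vector_right_distrib matrix_vector_mul_assoc inv)
  next
    fix X assume "A *v h10_bracket X Y + c X = 0"
    then have "matrix_inv A *v (A *v h10_bracket X Y + c X) = 0" by simp
    then show "h10_bracket X Y + matrix_inv A *v c X = 0"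
      by (simp add: matrix_vector_right_distrib matrix_vector_mul_assoc inv)
  qed
  also have "\<dots> \<longleftrightarrow> (\<forall>X Z. (A *v h10_bracket X Y + c X) \<bullet> Z = 0)"
    by (metis inner_eq_zero_iff inner_zero_left)
  also have "\<dots> \<longleftrightarrow> (\<forall>X Z. h10_bracket X Y \<bullet> (A *v Z) + h10_bracket X Z \<bullet> (A *v Y)
         + h10_bracket Y Z \<bullet> (A *v X) = 0)"
    using inner_matrix_symmetric[OF assms(1)]
    by (simp add: inner_left_distrib c inner_commute[of "A *v _"] add.assoc)
  finally show ?thesis .
qed

section \<open>The metrics \<open>g\<^sub>\<sigma>\<close>\<close>

lemma g_sigma_nth:
  fixes s0 s1 s2 s3 s4 s5 :: real
  defines "M \<equiv> g_sigma s0 s1 s2 s3 s4 s5"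
  shows "(M *v x) $ 1 = x $ 1" "(M *v x) $ 2 = x $ 2" "(M *v x) $ 3 = x $ 3"
    "(M *v x) $ 4 = (s0\<^sup>2 + s1\<^sup>2 + s3\<^sup>2) * x $ 4 + (s1 * s2 + s3 * s4) * x $ 5 + s3 * s5 * x $ 6"
    "(M *v x) $ 5 = (s1 * s2 + s3 * s4) * x $ 4 + (s2\<^sup>2 + s4\<^sup>2) * x $ 5 + s4 * s5 * x $ 6"
    "(M *v x) $ 6 = s3 * s5 * x $ 4 + s4 * s5 * x $ 5 + s5\<^sup>2 * x $ 6"
  by (simp_all add: M_def g_sigma_def matrix_vector_mult_def matrix_matrix_mult_def transpose_def
       sigma_def sum_UNIV_6 power2_eq_square algebra_simps)

lemma transpose_g_sigma: "transpose (g_sigma s0 s1 s2 s3 s4 s5) = g_sigma s0 s1 s2 s3 s4 s5"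
  by (simp add: g_sigma_def matrix_transpose_mul)

lemma invertible_g_sigma:
  assumes "s0 > 0" and "s2 > 0" and "s5 > 0"
  shows "invertible (g_sigma s0 s1 s2 s3 s4 s5)"
proof -
  let ?S = "sigma s0 s1 s2 s3 s4 s5"
  have "x = 0" if "?S *v x = 0" for x
    using that assms by (auto simp: vec_eq_iff forall_6 matrix_vector_mult_def sigma_def sum_UNIV_6)
  then have "invertible ?S"
    by (simp add: invertible_left_inverse matrix_left_invertible_ker)
  then show ?thesis
    unfolding g_sigma_def by (intro invertible_mult transpose_invertible)
qed

text \<open>The vector \<open>w y\<close> is \<open>[y, e\<^sub>1]\<close>, which lies in the derived algebra. The six
  equations amount to the vanishing of the form on \<open>(e\<^sub>2, e\<^sub>4)\<close> and on \<open>(e\<^sub>1, e\<^sub>k)\<close> for \<open>k \<ge> 2\<close>, and they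
  suffice because the form expands into the left sides of these equations.\<close>

lemma symmetry_space_g_sigma_iff:
  fixes s0 s1 s2 s3 s4 s5 :: real
  assumes "s0 > 0" and "s2 > 0" and "s5 > 0"
  defines "M \<equiv> g_sigma s0 s1 s2 s3 s4 s5"
  defines "w \<equiv> \<lambda>y. y$2 *\<^sub>R e 4 + y$3 *\<^sub>R e 5 + y$4 *\<^sub>R e 6"
  shows "y \<in> symmetry_space M \<longleftrightarrow> y $ 1 = 0 \<and> (M *v y) $ 4 = 0 \<and> (M *v y) $ 5 = 0
     \<and> (M *v w y) $ 4 = - (M *v y) $ 6 \<and> (M *v w y) $ 5 = 0 \<and> (M *v w y) $ 6 = 0"
    (is "_ \<longleftrightarrow> ?R")
proof -
  have W: "w y $ 1 = 0" "w y $ 2 = 0" "w y $ 3 = 0" "w y $ 4 = y $ 2" "w y $ 5 = y $ 3"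
    "w y $ 6 = y $ 4"
    by (simp_all add: w_def axis_def)
  define T where "T X Z = h10_bracket X y \<bullet> (M *v Z) + h10_bracket X Z \<bullet> (M *v y)
         + h10_bracket y Z \<bullet> (M *v X)" for X Z
  have iff: "y \<in> symmetry_space M \<longleftrightarrow> (\<forall>X Z. T X Z = 0)"
    unfolding M_def T_def
    by (rule symmetry_space_iff[OF transpose_g_sigma invertible_g_sigma[OF assms(1-3)]])
  \<comment> \<open>Only brackets with \<open>e\<^sub>1\<close> contribute, so every term carries \<open>y\<^sub>1\<close>, \<open>X\<^sub>1\<close> or \<open>Z\<^sub>1\<close>.\<close>
  have T: "T X Z =
     y$1 * (X$2 * (M *v Z)$4 + X$3 * (M *v Z)$5 + X$4 * (M *v Z)$6
          - Z$2 * (M *v X)$4 - Z$3 * (M *v X)$5 - Z$4 * (M *v X)$6)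
      - X$1 * (Z$4 * (M *v w y)$4 + Z$5 * (M *v w y)$5 + Z$6 * (M *v w y)$6)
      + Z$1 * (X$4 * (M *v w y)$4 + X$5 * (M *v w y)$5 + X$6 * (M *v w y)$6)
      - (X$1 * Z$2 - X$2 * Z$1) * (M *v y)$4 - (X$1 * Z$3 - X$3 * Z$1) * (M *v y)$5
      - (X$1 * Z$4 - X$4 * Z$1) * (M *v y)$6" for X Z
    unfolding T_def inner_vec_def sum_UNIV_6 h10_bracket_nth M_def g_sigma_nth W inner_real_def
    by algebra
  have "?R" if "\<forall>X Z. T X Z = 0"
  proof -
    have "T (e 2) (e 4) = 0" "T (e 1) (e 2) = 0" "T (e 1) (e 3) = 0" "T (e 1) (e 4) = 0"
      "T (e 1) (e 5) = 0" "T (e 1) (e 6) = 0"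
      using that by auto
    moreover have "s0\<^sup>2 + s1\<^sup>2 + s3\<^sup>2 > 0"
      using assms(1) by (simp add: add_pos_nonneg)
    ultimately show ?R
      unfolding T by (simp add: axis_def M_def g_sigma_nth)
  qed
  moreover have "T X Z = 0" if "?R" for X Z
    using that unfolding T by (simp add: algebra_simps)
  ultimately show ?thesis
    unfolding iff by blast
qed

text \<open>Let \<open>B\<close> be the lower block of the metric and \<open>b = (g\<^sub>\<sigma> y)\<^sub>6\<close>. The equations say
  \<open>B w = (- b, 0, 0)\<close> and \<open>B (y\<^sub>4, y\<^sub>5, y\<^sub>6) = (0, 0, b)\<close> with \<open>w = (y\<^sub>2, y\<^sub>3, y\<^sub>4)\<close>. Pairing the
  first with \<open>(y\<^sub>4, y\<^sub>5, y\<^sub>6)\<close> and the second with \<open>w\<close> gives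
  \<open>b y\<^sub>4 = - b y\<^sub>4\<close> as \<open>B\<close> is symmetric, and \<open>b = 0\<close> makes
  \<open>y\<^sub>4\<close> vanish as well because \<open>B\<close> is regular. Once \<open>y\<^sub>4 = 0\<close>, the triangular shape of \<open>\<sigma>\<close> expresses
  every coordinate through \<open>y\<^sub>2\<close>, and the one equation left over is
  the condition on \<open>s\<^sub>3\<close> unless \<open>y\<^sub>2 = 0\<close>.\<close>

lemma symmetry_space_g_sigma_coordinates:
  fixes s0 s1 s2 s3 s4 s5 :: real
  assumes pos: "s0 > 0" "s2 > 0" "s5 > 0"
  shows "y \<in> symmetry_space (g_sigma s0 s1 s2 s3 s4 s5) \<longleftrightarrow>
     y $ 1 = 0 \<and> y $ 4 = 0 \<and> s2 * y $ 3 = - s1 * y $ 2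
     \<and> s2\<^sup>2 * s5 * y $ 5 = s0\<^sup>2 * s4 * y $ 2
     \<and> s2\<^sup>2 * s5\<^sup>2 * y $ 6 = - (s0\<^sup>2 * (s2\<^sup>2 + s4\<^sup>2) * y $ 2)
     \<and> (s2 * s3 - s1 * s4) * y $ 2 = 0" (is "_ \<longleftrightarrow> ?R")
proof -
  define y2 y3 y4 y5 y6 where y: "y2 = y $ 2" "y3 = y $ 3" "y4 = y $ 4" "y5 = y $ 5" "y6 = y $ 6"
  define b where "b = s3 * s5 * y4 + s4 * s5 * y5 + s5\<^sup>2 * y6"
  let ?E4 = "(s0\<^sup>2 + s1\<^sup>2 + s3\<^sup>2) * y4 + (s1 * s2 + s3 * s4) * y5 + s3 * s5 * y6 = 0"
  let ?E5 = "(s1 * s2 + s3 * s4) * y4 + (s2\<^sup>2 + s4\<^sup>2) * y5 + s4 * s5 * y6 = 0"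
  let ?W4 = "(s0\<^sup>2 + s1\<^sup>2 + s3\<^sup>2) * y2 + (s1 * s2 + s3 * s4) * y3 + s3 * s5 * y4 = - b"
  let ?W5 = "(s1 * s2 + s3 * s4) * y2 + (s2\<^sup>2 + s4\<^sup>2) * y3 + s4 * s5 * y4 = 0"
  let ?W6 = "s3 * s5 * y2 + s4 * s5 * y3 + s5\<^sup>2 * y4 = 0"
  have iff: "y \<in> symmetry_space (g_sigma s0 s1 s2 s3 s4 s5) \<longleftrightarrow>
      y $ 1 = 0 \<and> ?E4 \<and> ?E5 \<and> ?W4 \<and> ?W5 \<and> ?W6"
    unfolding symmetry_space_g_sigma_iff[OF pos] g_sigma_nth b_def y
    by (simp add: axis_def)
  have "?R" if E4: ?E4 and E5: ?E5 and W4: ?W4 and W5: ?W5 and W6: ?W6 and "y $ 1 = 0"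
  proof -
    \<comment> \<open>The two pairings described above, subtracted.\<close>
    have "2 * b * y4 = 0"
      using E4 E5 W4 W5 W6 unfolding b_def by algebra
    then have "b = 0 \<or> y4 = 0"
      by simp
    moreover have "y4 = 0" if "b = 0"
    proof -
      have "s5 * (s3 * y4 + s4 * y5 + s5 * y6) = 0"
        using that unfolding b_def by algebra
      then have L: "s3 * y4 + s4 * y5 + s5 * y6 = 0"
        using pos by simp
      have "s2 * (s1 * y4 + s2 * y5) = 0"
        using E5 L by algebra
      then have "s1 * y4 + s2 * y5 = 0"
        using pos by simp
      with E4 L have "s0\<^sup>2 * y4 = 0"
        by algebra
      then show ?thesis
        using pos by simp
    qed
    ultimately have y4: "y4 = 0"
      by blast
    \<comment> \<open>Back substitution through the upper triangular factor \<open>\<sigma>\<^sup>T\<close> in the system for \<open>w\<close>: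
      rows 6, 5 and 4, in this order, determine the entries of \<open>\<sigma> w\<close>.\<close>
    have "s5 * (s3 * y2 + s4 * y3) = 0"
      using W6 y4 by algebra
    then have L: "s3 * y2 + s4 * y3 = 0"
      using pos by simp
    have "s2 * (s1 * y2 + s2 * y3) = 0"
      using W5 y4 L by algebra
    then have K: "s1 * y2 + s2 * y3 = 0"
      using pos by simp
    have b: "b = - s0\<^sup>2 * y2"
      using W4 y4 L K by algebra
    have y5: "s2\<^sup>2 * s5 * y5 = s0\<^sup>2 * s4 * y2"
      using E5 y4 b unfolding b_def by algebra
    have "s2\<^sup>2 * s5\<^sup>2 * y6 = - (s0\<^sup>2 * (s2\<^sup>2 + s4\<^sup>2) * y2)"
      using y5 y4 b unfolding b_def by algebra
    moreover have "(s2 * s3 - s1 * s4) * y2 = 0"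
      using L K by algebra
    moreover have "s2 * y3 = - s1 * y2"
      using K by algebra
    ultimately show ?R
      using y4 y5 \<open>y $ 1 = 0\<close> unfolding y by blast
  qed
  moreover have "?E4 \<and> ?E5 \<and> ?W4 \<and> ?W5 \<and> ?W6" if ?R
  proof -
    have R: "y4 = 0" "s2 * y3 = - s1 * y2" "s2\<^sup>2 * s5 * y5 = s0\<^sup>2 * s4 * y2"
      "s2\<^sup>2 * s5\<^sup>2 * y6 = - (s0\<^sup>2 * (s2\<^sup>2 + s4\<^sup>2) * y2)" "(s2 * s3 - s1 * s4) * y2 = 0"
      using that unfolding y by auto
    have "s2\<^sup>2 * (s5 * (s4 * y5 + s5 * y6) + s0\<^sup>2 * y2) = 0"
      using R by algebra
    then have L: "s5 * (s4 * y5 + s5 * y6) + s0\<^sup>2 * y2 = 0"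
      using pos by simp
    have "s2 * s5 * (s1 * s2 * y5 + s3 * (s4 * y5 + s5 * y6)) = 0"
      using R L by algebra
    then have E4: "s1 * s2 * y5 + s3 * (s4 * y5 + s5 * y6) = 0"
      using pos by simp
    have "s5 * (s2\<^sup>2 * y5 + s4 * (s4 * y5 + s5 * y6)) = 0"
      using R L by algebra
    then have E5: "s2\<^sup>2 * y5 + s4 * (s4 * y5 + s5 * y6) = 0"
      using pos by simp
    have "s2 * (s3 * y2 + s4 * y3) = 0"
      using R by algebra
    then have W: "s3 * y2 + s4 * y3 = 0"
      using pos by simp
    have ?E4 using E4 R(1) by algebra
    moreover have ?E5 using E5 R(1) by algebra
    moreover have ?W4 using L W R(1,2) unfolding b_def by algebra
    moreover have ?W5 using W R(1,2) by algebra
    moreover have ?W6 using W R(1) by algebra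
    ultimately show ?thesis by blast
  qed
  ultimately show ?thesis
    unfolding iff by blast
qed

lemma symmetry_space_g_sigma:
  fixes s0 s1 s2 s3 s4 s5 :: real
  assumes pos: "s0 > 0" "s2 > 0" "s5 > 0"
  shows "symmetry_space (g_sigma s0 s1 s2 s3 s4 s5) =
    (if s3 = s1 * s4 / s2
     then span {e 2 - (s1 / s2) *\<^sub>R e 3 + (s0\<^sup>2 * s4 / (s2\<^sup>2 * s5)) *\<^sub>R e 5
                - ((s0\<^sup>2 * s2\<^sup>2 + s0\<^sup>2 * s4\<^sup>2) / (s2\<^sup>2 * s5\<^sup>2)) *\<^sub>R e 6}
     else {0})" (is "?S = (if ?C then span {?Y} else {0})")
proof -
  have C: "?C \<longleftrightarrow> s2 * s3 - s1 * s4 = 0"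
    using pos by (auto simp: field_simps)
  have line: "s2 * y $ 3 = - s1 * y $ 2 \<longleftrightarrow> y $ 3 = y $ 2 * - (s1 / s2)"
    "s2\<^sup>2 * s5 * y $ 5 = s0\<^sup>2 * s4 * y $ 2 \<longleftrightarrow> y $ 5 = y $ 2 * (s0\<^sup>2 * s4 / (s2\<^sup>2 * s5))"
    "s2\<^sup>2 * s5\<^sup>2 * y $ 6 = - (s0\<^sup>2 * (s2\<^sup>2 + s4\<^sup>2) * y $ 2) \<longleftrightarrow>
       y $ 6 = y $ 2 * - ((s0\<^sup>2 * s2\<^sup>2 + s0\<^sup>2 * s4\<^sup>2) / (s2\<^sup>2 * s5\<^sup>2))" for y :: "real^6"
    using pos by (auto simp: field_simps)
  have Y: "y = k *\<^sub>R ?Y \<longleftrightarrow> y $ 1 = 0 \<and> y $ 2 = k \<and> y $ 3 = k * - (s1 / s2) \<and> y $ 4 = 0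
      \<and> y $ 5 = k * (s0\<^sup>2 * s4 / (s2\<^sup>2 * s5))
      \<and> y $ 6 = k * - ((s0\<^sup>2 * s2\<^sup>2 + s0\<^sup>2 * s4\<^sup>2) / (s2\<^sup>2 * s5\<^sup>2))" for y k
    unfolding vec_eq_iff forall_6 by (simp add: axis_def)
  have S: "y \<in> ?S \<longleftrightarrow> y = y $ 2 *\<^sub>R ?Y \<and> (?C \<or> y $ 2 = 0)" for y
    unfolding symmetry_space_g_sigma_coordinates[OF pos] line Y C by auto
  show ?thesis
  proof (cases ?C)
    case True
    have "y = y $ 2 *\<^sub>R ?Y \<longleftrightarrow> (\<exists>k. y = k *\<^sub>R ?Y)" for y
      using Y by metis
    then have "y \<in> ?S \<longleftrightarrow> y \<in> span {?Y}" for y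
      unfolding S span_singleton image_iff using True by blast
    then show ?thesis
      using True by auto
  next
    case False
    then have "y \<in> ?S \<longleftrightarrow> y = 0" for y
      unfolding S by (metis scaleR_zero_left zero_index)
    then show ?thesis
      using False by auto
  qed
qed

theorem theorem6p4:
  fixes s0 s1 s2 s3 s4 s5 :: real
  assumes "s0 > 0" and "s2 > 0" and "s5 > 0"
  shows "let g = g_sigma s0 s1 s2 s3 s4 s5;
             Y = e 2 - (s1 / s2) *\<^sub>R e 3 + (s0\<^sup>2 * s4 / (s2\<^sup>2 * s5)) *\<^sub>R e 5
                 - ((s0\<^sup>2 * s2\<^sup>2 + s0\<^sup>2 * s4\<^sup>2) / (s2\<^sup>2 * s5\<^sup>2)) *\<^sub>R e 6
         in (symmetry_index g > 0 \<longleftrightarrow> s3 = s1 * s4 / s2)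
          \<and> (s3 = s1 * s4 / s2 \<longrightarrow>
               symmetry_index g = 1
             \<and> (\<forall>p. symmetry_distribution g p = span {left_invariant_field Y p})
             \<and> Y \<notin> h10_center)"
proof -
  define Y where "Y = e 2 - (s1 / s2) *\<^sub>R e 3 + (s0\<^sup>2 * s4 / (s2\<^sup>2 * s5)) *\<^sub>R e 5
                 - ((s0\<^sup>2 * s2\<^sup>2 + s0\<^sup>2 * s4\<^sup>2) / (s2\<^sup>2 * s5\<^sup>2)) *\<^sub>R e 6"
  define g where "g = g_sigma s0 s1 s2 s3 s4 s5"
  have S: "symmetry_space g = (if s3 = s1 * s4 / s2 then span {Y} else {0})"
    unfolding g_def Y_def by (rule symmetry_space_g_sigma[OF assms])
  have Y12: "Y $ 1 = 0" "Y $ 2 = 1"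
    by (simp_all add: Y_def axis_def)
  then have dim: "dim (span {Y}) = 1"
    by (auto simp: dim_singleton)
  have "symmetry_distribution g p = span {left_invariant_field Y p}" if "s3 = s1 * s4 / s2" for p
  proof -
    have "linear (\<lambda>X. left_invariant_field X p)"
      by (rule linearI)
        (simp_all add: left_invariant_field_eq linear_add[OF linear_h10_bracket(1)]
          linear_cmul[OF linear_h10_bracket(1)] algebra_simps)
    from linear_span_image[OF this, of "{Y}"] show ?thesis
      using that by (simp add: symmetry_distribution_def S)
  qed
  moreover have "Y \<notin> h10_center"
  proof -
    have "h10_bracket (e 1) Y $ 4 \<noteq> 0"
      unfolding h10_bracket_nth using Y12 by (simp add: axis_def)
    then have "h10_bracket (e 1) Y \<noteq> 0"
      by auto
    then show ?thesis
      by (auto simp: h10_center_def)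
  qed
  ultimately show ?thesis
    unfolding Let_def Y_def[symmetric] g_def[symmetric] symmetry_index_def S
    using dim by simp
qed

end
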